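(* Let $k \geq 1$ be an integer and let $f = \sum_{n\geq 0} a_f(n)q^n$ be a quasimodular form for $\mathrm{SL}_2(\mathbb{Z})$ of weight $2k$, i.e. $f \in \widetilde{M}_{2k}$. If $a_f(n) = 0$ for all $0 \leq n \leq \left\lceil \frac{k^4 \log(k)}{2} \right\rceil$ (i.e. $\mathrm{ord}_\infty(f) > \left\lceil \frac{k^4 \log(k)}{2} \right\rceil$), then $f = 0$. Equivalently, $f$ is determined uniquely by its first $\left\lceil \frac{k^4 \log(k)}{2} \right\rceil + 1$ Fourier coefficients.
   Context: Let $q = e^{2\pi i z}$. The Eisenstein series are $E_2 = 1 - 24\sum_{n\geq1}\sigma_1(n)q^n$, $E_4 = 1 + 240\sum_{n \geq 1}\sigma_3(n)q^n$, $E_6 = 1 - 504\sum_{n\geq1}\sigma_5(n)q^n$, where $\sigma_\ell(n) = \sum_{d \mid n} d^\ell$. The space $\widetilde{M}_{2k}$ of quasimodular forms of weight $2k$ for $\mathrm{SL}_2(\mathbb{Z})$ is the $\mathbb{C}$-span of the products $E_2^a E_4^b E_6^c$ with $a,b,c \geq 0$ integers and $2a+4b+6c = 2k$, viewed as $q$-series. For $f = \sum a_f(n)q^n$, $\mathrm{ord}_\infty(f) = \min\{n : a_f(n)\neq 0\}$. *)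

theory Defs
  imports Complex_Main "HOL-Computational_Algebra.Formal_Power_Series"
begin

definition sigma :: "nat \<Rightarrow> nat \<Rightarrow> nat" where
  "sigma l n = (\<Sum>d | d dvd n. d ^ l)"

definition E2 :: "complex fps" where
  "E2 = Abs_fps (\<lambda>n. if n = 0 then 1 else - 24 * of_nat (sigma 1 n))"

definition E4 :: "complex fps" where
  "E4 = Abs_fps (\<lambda>n. if n = 0 then 1 else 240 * of_nat (sigma 3 n))"

definition E6 :: "complex fps" where
  "E6 = Abs_fps (\<lambda>n. if n = 0 then 1 else - 504 * of_nat (sigma 5 n))"

definition wt_triples :: "nat \<Rightarrow> (nat \<times> nat \<times> nat) set" where
  "wt_triples k = {(a, b, c). 2 * a + 4 * b + 6 * c = 2 * k}"

text \<open>The space of quasimodular forms of weight 2k: the complex span of the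
  products E2^a E4^b E6^c with 2a+4b+6c = 2k, viewed as q-series.\<close>
definition QM :: "nat \<Rightarrow> complex fps set" where
  "QM k = {f. \<exists>coef :: nat \<times> nat \<times> nat \<Rightarrow> complex.
      f = (\<Sum>(a, b, c) \<in> wt_triples k. fps_const (coef (a, b, c)) * E2 ^ a * E4 ^ b * E6 ^ c)}"

end

theory Submission
  imports Defs "Subresultants.Subresultant_Gcd" "HOL-Computational_Algebra.Field_as_Ring"
begin

text \<open>Put x = E2 / sqrt E4 and r = E6 / sqrt E4 ^ 3. A quasimodular form of weight 2k is
  sqrt E4 ^ k times F(x, r) for a polynomial F of degree at most k in x and at most k/3 in r, and by
  Ramanujan's differential equations q d/dq acts on such polynomials as a polynomial vector field, up
  to a unit power series. If F and its derivative F' along the field have no common factor involving x,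
  their resultant is a nonzero polynomial in r alone, and it vanishes to at least the same order in q
  as F(x, r); since r - 1 has order exactly 1, that order is at most the degree of the resultant, which
  is quadratic in k. A proper common factor is handled by induction, because orders are additive and
  the bound is superadditive. The remaining case F | F' occurs only if r - 1 or r + 1 divides F.

  Ramanujan's equations amount to convolution identities for divisor sums, which are proved by a
  telescoping argument over the positive solutions of ax + by = n.\<close>

section \<open>Convolutions of divisor sums and Ramanujan's equations\<close>

text \<open>Recording the cofactors \<open>x\<close> and \<open>y\<close> of the divisors
  \<open>a\<close> and \<open>b\<close> makes the shear of \<open>sum_reps_telescope\<close>
  possible.\<close>

definition reps :: "nat \<Rightarrow> (nat \<times> nat \<times> nat \<times> nat) set" where
  "reps n = {(a, b, x, y). 0 < a \<and> 0 < b \<and> 0 < x \<and> 0 < y \<and> a * x + b * y = n}"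

lemma finite_reps: "finite (reps n)"
proof (rule finite_subset)
  show "reps n \<subseteq> {..n} \<times> {..n} \<times> {..n} \<times> {..n}"
  proof
    fix p assume "p \<in> reps n"
    then obtain a b x y where p: "p = (a, b, x, y)"
      and *: "a * x + b * y = n" "0 < a" "0 < b" "0 < x" "0 < y" by (auto simp: reps_def)
    have "a * x \<le> n" "b * y \<le> n" using *(1) by auto
    moreover have "a \<le> a * x" "x \<le> a * x" "b \<le> b * y" "y \<le> b * y" using * by auto
    ultimately have "a \<le> n \<and> x \<le> n \<and> b \<le> n \<and> y \<le> n" by (meson le_trans)
    then show "p \<in> {..n} \<times> {..n} \<times> {..n} \<times> {..n}" by (simp add: p)
  qed
qed auto

text \<open>Every number divides \<open>0\<close>, and a sum over an infinite set is
  \<open>0\<close> by convention.\<close>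

lemma sigma_0 [simp]: "sigma l 0 = 0"
  by (simp add: sigma_def)

lemma sigma_convolution:
  "(\<Sum>i=0..n. sigma k i * sigma l (n - i)) = (\<Sum>(a, b, x, y)\<in>reps n. a ^ k * b ^ l)"
proof -
  have "(\<Sum>i=0..n. sigma k i * sigma l (n - i)) = (\<Sum>i\<in>{0<..<n}. sigma k i * sigma l (n - i))"
    by (rule sum.mono_neutral_right) (auto simp: not_less)
  also have "\<dots> = (\<Sum>i\<in>{0<..<n}. \<Sum>(a, b)\<in>{d. d dvd i} \<times> {d. d dvd n - i}. a ^ k * b ^ l)"
    by (simp add: sigma_def sum_product sum.cartesian_product)
  also have "\<dots> = (\<Sum>(i, a, b)\<in>(SIGMA i:{0<..<n}. {d. d dvd i} \<times> {d. d dvd n - i}). a ^ k * b ^ l)"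
    by (subst sum.Sigma) (auto simp: case_prod_unfold intro!: finite_cartesian_product)
  also have "\<dots> = (\<Sum>(a, b, x, y)\<in>reps n. a ^ k * b ^ l)"
    by (rule sum.reindex_bij_witness[where i = "\<lambda>(a, b, x, y). (a * x, a, b)"
          and j = "\<lambda>(i, a, b). (a, b, i div a, (n - i) div b)"])
       (auto simp: reps_def dvd_div_eq_0_iff intro!: Nat.gr0I)
  finally show ?thesis .
qed

lemma sum_trichotomy:
  fixes u v :: "'a \<Rightarrow> 'b::linorder"
  assumes "finite S"
  shows "sum f S = sum f {p\<in>S. u p < v p} + sum f {p\<in>S. v p < u p} + sum f {p\<in>S. u p = v p}"
proof -
  have "S = ({p\<in>S. u p < v p} \<union> {p\<in>S. v p < u p}) \<union> {p\<in>S. u p = v p}" by auto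
  then have "sum f S = sum f (({p\<in>S. u p < v p} \<union> {p\<in>S. v p < u p}) \<union> {p\<in>S. u p = v p})" by simp
  also have "\<dots> = sum f ({p\<in>S. u p < v p} \<union> {p\<in>S. v p < u p}) + sum f {p\<in>S. u p = v p}"
    using assms by (intro sum.union_disjoint) auto
  also have "sum f ({p\<in>S. u p < v p} \<union> {p\<in>S. v p < u p}) = sum f {p\<in>S. u p < v p} + sum f {p\<in>S. v p < u p}"
    using assms by (intro sum.union_disjoint) auto
  finally show ?thesis .
qed

text \<open>Here (a + b) x = n, so \<open>d = a + b\<close> is a divisor of \<open>n\<close> and
  \<open>b\<close> ranges over \<open>1..<d\<close>.\<close>

lemma sum_reps_diagonal_xy:
  fixes h :: "nat \<Rightarrow> nat \<Rightarrow> int"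
  assumes "0 < n"
  shows "(\<Sum>(a, b, x, y)\<in>{(a, b, x, y)\<in>reps n. x = y}. h a b)
       = (\<Sum>d | d dvd n. \<Sum>b\<in>{1..<d}. h (d - b) b)"
proof -
  have "(\<Sum>d | d dvd n. \<Sum>b\<in>{1..<d}. h (d - b) b)
      = (\<Sum>(d, b)\<in>(SIGMA d:{d. d dvd n}. {1..<d}). h (d - b) b)"
    using assms by (subst sum.Sigma) auto
  also have "\<dots> = (\<Sum>(a, b, x, y)\<in>{(a, b, x, y)\<in>reps n. x = y}. h a b)"
    by (rule sum.reindex_bij_witness[where i = "\<lambda>(a, b, x, y). (a + b, b)"
          and j = "\<lambda>(d, b). (d - b, b, n div d, n div d)"])
       (use assms in \<open>auto simp: reps_def add_mult_distrib[symmetric] dvd_div_eq_0_iff elim!: dvdE intro!: Nat.gr0I\<close>)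
  finally show ?thesis by simp
qed

text \<open>Here a (x + y) = n with \<open>d = a\<close>, and \<open>n div d\<close> splits as x + y
  in \<open>n div d - 1\<close> ways.\<close>

lemma sum_reps_diagonal_ab:
  fixes h :: "nat \<Rightarrow> nat \<Rightarrow> int"
  assumes "0 < n"
  shows "(\<Sum>(a, b, x, y)\<in>{(a, b, x, y)\<in>reps n. a = b}. h a b)
       = (\<Sum>d | d dvd n. (int (n div d) - 1) * h d d)"
proof -
  have "(\<Sum>d | d dvd n. (int (n div d) - 1) * h d d) = (\<Sum>d | d dvd n. \<Sum>x\<in>{1..<n div d}. h d d)"
    using assms by (intro sum.cong) (auto elim!: dvdE simp: of_nat_diff)
  also have "\<dots> = (\<Sum>(d, x)\<in>(SIGMA d:{d. d dvd n}. {1..<n div d}). h d d)"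
    using assms by (subst sum.Sigma) auto
  also have "\<dots> = (\<Sum>(a, b, x, y)\<in>{(a, b, x, y)\<in>reps n. a = b}. h a b)"
    by (rule sum.reindex_bij_witness[where i = "\<lambda>(a, b, x, y). (a, x)"
          and j = "\<lambda>(d, x). (d, d, x, n div d - x)"])
       (use assms in \<open>auto simp: reps_def add_mult_distrib2[symmetric] elim!: dvdE intro!: Nat.gr0I\<close>)
  finally show ?thesis by simp
qed

text \<open>The shear (a, b, x, y) -> (a - b, b, x, x + y) maps the solutions of ax + by = n with
  a > b onto those with y > x; combined with the symmetry (a, b, x, y) -> (b, a, y, x) everything
  cancels except the diagonals a = b and x = y.\<close>

lemma sum_reps_telescope:
  fixes g :: "nat \<Rightarrow> nat \<Rightarrow> int"
  assumes n: "0 < n"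
    and sym: "\<And>a b. g a b = g b a"
    and shift: "\<And>a b. g (a + b) b = g (a + b) a"
  shows "(\<Sum>(a, b, x, y)\<in>reps n. g (a + b) b - g a b)
       = (\<Sum>d | d dvd n. (\<Sum>b<d. g d b) - int (n div d) * g d d)"
proof -
  define lt where "lt h = (\<Sum>(a, b, x, y)\<in>{(a, b, x, y)\<in>reps n. x < y}. h a b)"
    for h :: "nat \<Rightarrow> nat \<Rightarrow> int"
  have split_xy: "(\<Sum>(a, b, x, y)\<in>reps n. h a b)
      = 2 * lt h + (\<Sum>(a, b, x, y)\<in>{(a, b, x, y)\<in>reps n. x = y}. h a b)"
    if "\<And>a b. h a b = h b a" for h :: "nat \<Rightarrow> nat \<Rightarrow> int"
  proof -
    have "(\<Sum>(a, b, x, y)\<in>{(a, b, x, y)\<in>reps n. y < x}. h a b) = lt h"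
      unfolding lt_def
      by (rule sum.reindex_bij_witness[where i = "\<lambda>(a, b, x, y). (b, a, y, x)"
            and j = "\<lambda>(a, b, x, y). (b, a, y, x)"]) (auto simp: reps_def that)
    then show ?thesis
      using sum_trichotomy[OF finite_reps, of "\<lambda>(a, b, x, y). h a b" n
          "\<lambda>(a, b, x, y). x" "\<lambda>(a, b, x, y). y"]
      by (simp add: lt_def case_prod_unfold)
  qed
  have swap: "(\<Sum>(a, b, x, y)\<in>{(a, b, x, y)\<in>reps n. a < b}. g a b)
      = (\<Sum>(a, b, x, y)\<in>{(a, b, x, y)\<in>reps n. b < a}. g a b)"
    by (rule sum.reindex_bij_witness[where i = "\<lambda>(a, b, x, y). (b, a, y, x)"
          and j = "\<lambda>(a, b, x, y). (b, a, y, x)"]) (auto simp: reps_def sym)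
  have shear: "(\<Sum>(a, b, x, y)\<in>{(a, b, x, y)\<in>reps n. b < a}. g a b) = lt (\<lambda>a b. g (a + b) b)"
    unfolding lt_def
    by (rule sum.reindex_bij_witness[where i = "\<lambda>(a, b, x, y). (a + b, b, x, y - x)"
          and j = "\<lambda>(a, b, x, y). (a - b, b, x, x + y)"])
       (auto simp: reps_def less_iff_Suc_add algebra_simps)
  have split_ab: "(\<Sum>(a, b, x, y)\<in>reps n. g a b)
      = 2 * lt (\<lambda>a b. g (a + b) b) + (\<Sum>(a, b, x, y)\<in>{(a, b, x, y)\<in>reps n. a = b}. g a b)"
    using sum_trichotomy[OF finite_reps, of "\<lambda>(a, b, x, y). g a b" n
          "\<lambda>(a, b, x, y). a" "\<lambda>(a, b, x, y). b"] swap shear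
    by (simp add: case_prod_unfold)
  \<comment> \<open>\<open>shift\<close> makes \<open>g (a + b) b\<close> symmetric in
    \<open>a\<close> and \<open>b\<close>, as \<open>split_xy\<close> requires.\<close>
  have "(\<Sum>(a, b, x, y)\<in>reps n. g (a + b) b)
      = 2 * lt (\<lambda>a b. g (a + b) b) + (\<Sum>(a, b, x, y)\<in>{(a, b, x, y)\<in>reps n. x = y}. g (a + b) b)"
    by (rule split_xy) (metis add.commute shift)
  moreover have "(\<Sum>(a, b, x, y)\<in>{(a, b, x, y)\<in>reps n. x = y}. g (a + b) b)
      = (\<Sum>d | d dvd n. \<Sum>b\<in>{1..<d}. g d b)"
    using sum_reps_diagonal_xy[OF n, of "\<lambda>a b. g (a + b) b"] by simp
  ultimately have "(\<Sum>(a, b, x, y)\<in>reps n. g (a + b) b - g a b)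
      = (\<Sum>d | d dvd n. (\<Sum>b\<in>{1..<d}. g d b) - (int (n div d) - 1) * g d d)"
    using split_ab sum_reps_diagonal_ab[OF n, of g]
    by (simp add: sum_subtractf case_prod_unfold)
  \<comment> \<open>One copy of \<open>g d d\<close> becomes the term \<open>b = 0\<close>, because
    \<open>shift\<close> gives \<open>g d 0 = g d d\<close>.\<close>
  also have "\<dots> = (\<Sum>d | d dvd n. (\<Sum>b<d. g d b) - int (n div d) * g d d)"
  proof (rule sum.cong)
    fix d assume "d \<in> {d. d dvd n}"
    then have "0 < d" using n by (auto intro: Nat.gr0I)
    then have "(\<Sum>b<d. g d b) = g d 0 + (\<Sum>b\<in>{1..<d}. g d b)"
      by (simp add: lessThan_atLeast0 sum.atLeast_Suc_lessThan)
    moreover have "g d 0 = g d d" using shift[of d 0] by simp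
    ultimately show "(\<Sum>b\<in>{1..<d}. g d b) - (int (n div d) - 1) * g d d
        = (\<Sum>b<d. g d b) - int (n div d) * g d d"
      by (simp add: algebra_simps)
  qed simp
  finally show ?thesis .
qed

section \<open>Convolution identities for divisor sums\<close>

definition conv :: "nat \<Rightarrow> nat \<Rightarrow> nat \<Rightarrow> int" where
  "conv k l n = (\<Sum>i=0..n. int (sigma k i) * int (sigma l (n - i)))"

lemma conv_eq_sum_reps: "conv k l n = (\<Sum>(a, b, x, y)\<in>reps n. int a ^ k * int b ^ l)"
proof -
  have "conv k l n = int (\<Sum>i=0..n. sigma k i * sigma l (n - i))"
    by (simp add: conv_def)
  then show ?thesis
    by (simp only: sigma_convolution) (simp add: case_prod_unfold)
qed

lemma conv_commute: "conv k l n = conv l k n"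
  unfolding conv_def
  by (rule sum.reindex_bij_witness[where i = "\<lambda>i. n - i" and j = "\<lambda>i. n - i"]) auto

lemma of_nat_sigma: "of_nat (sigma l n) = (\<Sum>d | d dvd n. of_nat d ^ l)"
  by (simp add: sigma_def)

lemma int_div_mult_power: "d dvd n \<Longrightarrow> int (n div d) * int d ^ Suc l = int n * int d ^ l"
  by (auto elim!: dvdE)

text \<open>The form a^2 - ab + b^2 is invariant under swapping a and b and under b -> a - b, the
  symmetries that \<open>sum_reps_telescope\<close> asks for; the shear a -> a + b changes it by
  2ab.\<close>

lemma conv_1_1:
  "12 * conv 1 1 n = 5 * int (sigma 3 n) + int (sigma 1 n) - 6 * int n * int (sigma 1 n)"
proof (cases "n = 0")
  case False
  define g :: "nat \<Rightarrow> nat \<Rightarrow> int"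
    where "g a b = 6 * (int a ^ 2 - int a * int b + int b ^ 2)" for a b
  have "12 * conv 1 1 n = (\<Sum>(a, b, x, y)\<in>reps n. g (a + b) b - g a b)"
    unfolding conv_eq_sum_reps sum_distrib_left
    by (intro sum.cong) (auto simp: g_def power2_eq_square algebra_simps)
  also have "\<dots> = (\<Sum>d | d dvd n. (\<Sum>b<d. g d b) - int (n div d) * g d d)"
    using False by (intro sum_reps_telescope) (auto simp: g_def power2_eq_square algebra_simps)
  also have "\<dots> = (\<Sum>d | d dvd n. 5 * int d ^ 3 + int d - 6 * int n * int d)"
  proof (intro sum.cong refl)
    fix d assume "d \<in> {d. d dvd n}"
    then have d: "int (n div d) * int d ^ 2 = int n * int d"
      using int_div_mult_power[of d n 1] by (simp add: numeral_2_eq_2)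
    have "(\<Sum>b<m. g d b) = 6 * int m * int d ^ 2 - 3 * int d * (int m * (int m - 1))
        + int m * (int m - 1) * (2 * int m - 1)" for m
      by (induction m) (auto simp: g_def power2_eq_square algebra_simps)
    from this[of d] have "(\<Sum>b<d. g d b) = 5 * int d ^ 3 + int d"
      by (simp add: power2_eq_square power3_eq_cube algebra_simps)
    moreover have "g d d = 6 * int d ^ 2" by (simp add: g_def power2_eq_square)
    ultimately show "(\<Sum>b<d. g d b) - int (n div d) * g d d = 5 * int d ^ 3 + int d - 6 * int n * int d"
      using d by (simp add: algebra_simps)
  qed
  finally show ?thesis
    by (simp add: of_nat_sigma sum.distrib sum_subtractf sum_distrib_left)
qed (simp add: conv_def)

text \<open>The square of the invariant form changes by 4ab(a^2 + b^2) under the shear, which mixes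
  \<open>conv 1 3\<close> with \<open>conv 3 1\<close>.\<close>

lemma conv_1_3:
  "240 * conv 1 3 n = 21 * int (sigma 5 n) + 10 * int (sigma 3 n) - int (sigma 1 n)
     - 30 * int n * int (sigma 3 n)"
proof (cases "n = 0")
  case False
  define g :: "nat \<Rightarrow> nat \<Rightarrow> int"
    where "g a b = 30 * (int a ^ 2 - int a * int b + int b ^ 2) ^ 2" for a b
  have "240 * conv 1 3 n = 120 * conv 1 3 n + 120 * conv 3 1 n"
    by (simp add: conv_commute[of 3])
  also have "\<dots> = (\<Sum>(a, b, x, y)\<in>reps n. g (a + b) b - g a b)"
    unfolding conv_eq_sum_reps sum_distrib_left sum.distrib[symmetric]
    by (intro sum.cong) (auto simp: g_def eval_nat_numeral algebra_simps)
  also have "\<dots> = (\<Sum>d | d dvd n. (\<Sum>b<d. g d b) - int (n div d) * g d d)"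
    using False by (intro sum_reps_telescope) (auto simp: g_def eval_nat_numeral algebra_simps)
  also have "\<dots> = (\<Sum>d | d dvd n. 21 * int d ^ 5 + 10 * int d ^ 3 - int d - 30 * int n * int d ^ 3)"
  proof (intro sum.cong refl)
    fix d assume "d \<in> {d. d dvd n}"
    then have d: "int (n div d) * int d ^ 4 = int n * int d ^ 3"
      using int_div_mult_power[of d n 3] by (simp add: eval_nat_numeral)
    have "(\<Sum>b<m. g d b) = 30 * int m * int d ^ 4 - 30 * int d ^ 3 * (int m * (int m - 1))
        + 15 * int d ^ 2 * (int m * (int m - 1) * (2 * int m - 1))
        - 15 * int d * (int m * (int m - 1)) ^ 2
        + int m * (int m - 1) * (2 * int m - 1) * (3 * int m ^ 2 - 3 * int m - 1)" for m
      by (induction m) (auto simp: g_def eval_nat_numeral algebra_simps)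
    from this[of d] have "(\<Sum>b<d. g d b) = 21 * int d ^ 5 + 10 * int d ^ 3 - int d"
      by (simp add: eval_nat_numeral algebra_simps)
    moreover have "g d d = 30 * int d ^ 4" by (simp add: g_def eval_nat_numeral)
    ultimately show "(\<Sum>b<d. g d b) - int (n div d) * g d d
        = 21 * int d ^ 5 + 10 * int d ^ 3 - int d - 30 * int n * int d ^ 3"
      using d by (simp add: algebra_simps)
  qed
  finally show ?thesis
    by (simp add: of_nat_sigma sum.distrib sum_subtractf sum_distrib_left)
qed (simp add: conv_def)

text \<open>The square of ab(a - b) has both symmetries and changes by 4 a^3 b^3. It vanishes for a
  = b, so no term with a factor \<open>n\<close> appears.\<close>

lemma conv_3_3: "120 * conv 3 3 n = int (sigma 7 n) - int (sigma 3 n)"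
proof (cases "n = 0")
  case False
  define g :: "nat \<Rightarrow> nat \<Rightarrow> int"
    where "g a b = 30 * (int a * int b * (int a - int b)) ^ 2" for a b
  have "120 * conv 3 3 n = (\<Sum>(a, b, x, y)\<in>reps n. g (a + b) b - g a b)"
    unfolding conv_eq_sum_reps sum_distrib_left
    by (intro sum.cong) (auto simp: g_def eval_nat_numeral algebra_simps)
  also have "\<dots> = (\<Sum>d | d dvd n. (\<Sum>b<d. g d b) - int (n div d) * g d d)"
    using False by (intro sum_reps_telescope) (auto simp: g_def eval_nat_numeral algebra_simps)
  also have "\<dots> = (\<Sum>d | d dvd n. int d ^ 7 - int d ^ 3)"
  proof (intro sum.cong refl)
    fix d assume "d \<in> {d. d dvd n}"
    have "(\<Sum>b<m. g d b) = 5 * int d ^ 4 * (int m * (int m - 1) * (2 * int m - 1))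
        - 15 * int d ^ 3 * (int m * (int m - 1)) ^ 2
        + int d ^ 2 * (int m * (int m - 1) * (2 * int m - 1) * (3 * int m ^ 2 - 3 * int m - 1))" for m
      by (induction m) (auto simp: g_def eval_nat_numeral algebra_simps)
    from this[of d] have "(\<Sum>b<d. g d b) = int d ^ 7 - int d ^ 3"
      by (simp add: eval_nat_numeral algebra_simps)
    then show "(\<Sum>b<d. g d b) - int (n div d) * g d d = int d ^ 7 - int d ^ 3"
      by (simp add: g_def)
  qed
  finally show ?thesis
    by (simp add: of_nat_sigma sum_subtractf)
qed (simp add: conv_def)

text \<open>The shear turns (a - b)^6 + a^6 + b^6 into (a + b)^6 + a^6 + b^6. The difference
  contains a^3 b^3, whence the contribution of \<open>conv 3 3\<close>.\<close>

lemma conv_1_5_3_3: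
  "504 * conv 1 5 n + 840 * conv 3 3 n = 27 * int (sigma 7 n) + 21 * int (sigma 5 n)
     - 7 * int (sigma 3 n) + int (sigma 1 n) - 42 * int n * int (sigma 5 n)"
proof (cases "n = 0")
  case False
  define g :: "nat \<Rightarrow> nat \<Rightarrow> int"
    where "g a b = 21 * ((int a - int b) ^ 6 + int a ^ 6 + int b ^ 6)" for a b
  have "504 * conv 1 5 n + 840 * conv 3 3 n = 252 * conv 1 5 n + 252 * conv 5 1 n + 840 * conv 3 3 n"
    by (simp add: conv_commute[of 5])
  also have "\<dots> = (\<Sum>(a, b, x, y)\<in>reps n. g (a + b) b - g a b)"
    unfolding conv_eq_sum_reps sum_distrib_left sum.distrib[symmetric]
    by (intro sum.cong) (auto simp: g_def eval_nat_numeral algebra_simps)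
  also have "\<dots> = (\<Sum>d | d dvd n. (\<Sum>b<d. g d b) - int (n div d) * g d d)"
    using False by (intro sum_reps_telescope) (auto simp: g_def eval_nat_numeral algebra_simps)
  also have "\<dots> = (\<Sum>d | d dvd n. 27 * int d ^ 7 + 21 * int d ^ 5 - 7 * int d ^ 3 + int d
      - 42 * int n * int d ^ 5)"
  proof (intro sum.cong refl)
    fix d assume "d \<in> {d. d dvd n}"
    then have d: "int (n div d) * int d ^ 6 = int n * int d ^ 5"
      using int_div_mult_power[of d n 5] by (simp add: eval_nat_numeral)
    \<comment> \<open>The factor 2 clears the half-integral coefficients of the power sums.\<close>
    have "2 * (\<Sum>b<m. g d b) = 84 * int m * int d ^ 6 - 126 * int d ^ 5 * (int m * (int m - 1))
        + 105 * int d ^ 4 * (int m * (int m - 1) * (2 * int m - 1))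
        - 210 * int d ^ 3 * (int m * (int m - 1)) ^ 2
        + 21 * int d ^ 2 * (int m * (int m - 1) * (2 * int m - 1) * (3 * int m ^ 2 - 3 * int m - 1))
        - 21 * int d * ((int m * (int m - 1)) ^ 2 * (2 * int m ^ 2 - 2 * int m - 1))
        + 2 * (int m * (int m - 1) * (2 * int m - 1) * (3 * int m ^ 4 - 6 * int m ^ 3 + 3 * int m + 1))" for m
      by (induction m) (auto simp: g_def eval_nat_numeral algebra_simps)
    from this[of d] have "(\<Sum>b<d. g d b) = 27 * int d ^ 7 + 21 * int d ^ 5 - 7 * int d ^ 3 + int d"
      by (simp add: eval_nat_numeral algebra_simps)
    moreover have "g d d = 42 * int d ^ 6" by (simp add: g_def)
    ultimately show "(\<Sum>b<d. g d b) - int (n div d) * g d d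
        = 27 * int d ^ 7 + 21 * int d ^ 5 - 7 * int d ^ 3 + int d - 42 * int n * int d ^ 5"
      using d by (simp add: algebra_simps)
  qed
  finally show ?thesis
    by (simp add: of_nat_sigma sum.distrib sum_subtractf sum_distrib_left)
qed (simp add: conv_def)

section \<open>Generating series and Ramanujan's differential equations\<close>

definition sigma_fps :: "nat \<Rightarrow> complex fps" where
  "sigma_fps l = Abs_fps (\<lambda>n. of_nat (sigma l n))"

lemma E2_eq: "E2 = 1 - 24 * sigma_fps 1"
  and E4_eq: "E4 = 1 + 240 * sigma_fps 3"
  and E6_eq: "E6 = 1 - 504 * sigma_fps 5"
  by (auto simp: fps_eq_iff E2_def E4_def E6_def sigma_fps_def numeral_fps_const)

lemma sigma_fps_mult_nth: "fps_nth (sigma_fps k * sigma_fps l) n = of_int (conv k l n)"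
  by (simp add: fps_mult_nth sigma_fps_def conv_def)

abbreviation theta :: "complex fps \<Rightarrow> complex fps" where
  "theta f \<equiv> fps_X * fps_deriv f"

lemma theta_nth: "fps_nth (theta f) n = of_nat n * fps_nth f n"
  by (cases n) auto

lemma sigma_fps_1_1:
  "12 * (sigma_fps 1 * sigma_fps 1) = 5 * sigma_fps 3 + sigma_fps 1 - 6 * theta (sigma_fps 1)"
proof (rule fps_ext)
  fix n
  show "fps_nth (12 * (sigma_fps 1 * sigma_fps 1)) n
      = fps_nth (5 * sigma_fps 3 + sigma_fps 1 - 6 * theta (sigma_fps 1)) n"
    using arg_cong[OF conv_1_1[of n], of "of_int :: int \<Rightarrow> complex"]
    by (simp add: numeral_fps_const sigma_fps_mult_nth theta_nth del: One_nat_def) (simp add: sigma_fps_def)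
qed

lemma sigma_fps_1_3:
  "240 * (sigma_fps 1 * sigma_fps 3)
     = 21 * sigma_fps 5 + 10 * sigma_fps 3 - sigma_fps 1 - 30 * theta (sigma_fps 3)"
proof (rule fps_ext)
  fix n
  show "fps_nth (240 * (sigma_fps 1 * sigma_fps 3)) n
      = fps_nth (21 * sigma_fps 5 + 10 * sigma_fps 3 - sigma_fps 1 - 30 * theta (sigma_fps 3)) n"
    using arg_cong[OF conv_1_3[of n], of "of_int :: int \<Rightarrow> complex"]
    by (simp add: numeral_fps_const sigma_fps_mult_nth theta_nth del: One_nat_def) (simp add: sigma_fps_def)
qed

lemma sigma_fps_3_3: "120 * (sigma_fps 3 * sigma_fps 3) = sigma_fps 7 - sigma_fps 3"
proof (rule fps_ext)
  fix n
  show "fps_nth (120 * (sigma_fps 3 * sigma_fps 3)) n = fps_nth (sigma_fps 7 - sigma_fps 3) n"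
    using arg_cong[OF conv_3_3[of n], of "of_int :: int \<Rightarrow> complex"]
    by (simp add: numeral_fps_const sigma_fps_mult_nth del: One_nat_def) (simp add: sigma_fps_def)
qed

lemma sigma_fps_1_5_3_3:
  "504 * (sigma_fps 1 * sigma_fps 5) + 840 * (sigma_fps 3 * sigma_fps 3)
     = 27 * sigma_fps 7 + 21 * sigma_fps 5 - 7 * sigma_fps 3 + sigma_fps 1 - 42 * theta (sigma_fps 5)"
proof (rule fps_ext)
  fix n
  show "fps_nth (504 * (sigma_fps 1 * sigma_fps 5) + 840 * (sigma_fps 3 * sigma_fps 3)) n
      = fps_nth (27 * sigma_fps 7 + 21 * sigma_fps 5 - 7 * sigma_fps 3 + sigma_fps 1
          - 42 * theta (sigma_fps 5)) n"
    using arg_cong[OF conv_1_5_3_3[of n], of "of_int :: int \<Rightarrow> complex"]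
    by (simp add: numeral_fps_const sigma_fps_mult_nth theta_nth del: One_nat_def) (simp add: sigma_fps_def)
qed

lemma Ramanujan_E2: "12 * theta E2 = E2 ^ 2 - E4"
proof -
  have "12 * theta E2 - (E2 ^ 2 - E4) = - 48 * (12 * (sigma_fps 1 * sigma_fps 1)
      - (5 * sigma_fps 3 + sigma_fps 1 - 6 * theta (sigma_fps 1)))"
    by (simp add: E2_eq E4_eq algebra_simps power2_eq_square del: One_nat_def)
  then show ?thesis unfolding sigma_fps_1_1 by simp
qed

lemma Ramanujan_E4: "3 * theta E4 = E2 * E4 - E6"
proof -
  have "3 * theta E4 - (E2 * E4 - E6) = 24 * (240 * (sigma_fps 1 * sigma_fps 3)
      - (21 * sigma_fps 5 + 10 * sigma_fps 3 - sigma_fps 1 - 30 * theta (sigma_fps 3)))"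
    by (simp add: E2_eq E4_eq E6_eq algebra_simps del: One_nat_def)
  then show ?thesis unfolding sigma_fps_1_3 by simp
qed

lemma Ramanujan_E6: "2 * theta E6 = E2 * E6 - E4 ^ 2"
proof -
  \<comment> \<open>The multiplier 648 = 24 * 27 is chosen so that \<open>sigma_fps 7\<close>
    cancels.\<close>
  have "2 * theta E6 - (E2 * E6 - E4 ^ 2)
      = - 24 * (504 * (sigma_fps 1 * sigma_fps 5) + 840 * (sigma_fps 3 * sigma_fps 3)
          - (27 * sigma_fps 7 + 21 * sigma_fps 5 - 7 * sigma_fps 3 + sigma_fps 1 - 42 * theta (sigma_fps 5)))
        + 648 * (120 * (sigma_fps 3 * sigma_fps 3) - (sigma_fps 7 - sigma_fps 3))"
    by (simp add: E2_eq E4_eq E6_eq algebra_simps power2_eq_square del: One_nat_def)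
  then show ?thesis unfolding sigma_fps_1_5_3_3 sigma_fps_3_3 by simp
qed

section \<open>Bivariate polynomials and resultants\<close>

text \<open>The Sylvester matrix applied to the column of monomials X^(d-1), ..., 1 gives shifted
  multiples of \<open>p\<close> and \<open>q\<close>. Multiplying by the last row of the adjugate
  leaves the determinant times the monomial 1.\<close>

lemma resultant_in_ideal:
  fixes p q :: "'a::comm_ring_1 poly"
  assumes "0 < degree p"
  obtains u v where "[:resultant p q:] = u * p + v * q"
proof -
  define m n d where "m = degree p" and "n = degree q" and "d = m + n"
  have d: "0 < d" using assms by (simp add: d_def m_def)
  have lift: "comm_ring_hom (\<lambda>c::'a. [:c:])" by unfold_locales auto
  define S where "S = map_mat (\<lambda>c. [:c:]) (sylvester_mat p q)"
  have S: "S \<in> carrier_mat d d" by (simp add: S_def d_def m_def n_def sylvester_carrier_mat)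
  have det: "det S = [:resultant p q:]"
    by (simp add: S_def comm_ring_hom.hom_det[OF lift] resultant_def)
  \<comment> \<open>\<open>w k\<close> is the polynomial whose coefficients form row
    \<open>k\<close>: first the shifts of \<open>p\<close>, then those of \<open>q\<close>.\<close>
  define w where "w k = (if k < n then monom 1 (n - 1 - k) * p else monom 1 (d - 1 - k) * q)" for k
  have sum_monom: "(\<Sum>j<d. monom (coeff P (d - 1 - j)) (d - 1 - j)) = P"
    if "degree P \<le> d - 1" for P :: "'a poly"
  proof -
    have "(\<Sum>j<d. monom (coeff P (d - 1 - j)) (d - 1 - j)) = (\<Sum>j<d. monom (coeff P j) j)"
      by (rule sum.reindex_bij_witness[where i = "\<lambda>j. d - 1 - j" and j = "\<lambda>j. d - 1 - j"]) auto
    also have "\<dots> = (\<Sum>j\<le>d - 1. monom (coeff P j) j)"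
      using d by (intro sum.cong) auto
    finally show ?thesis using poly_as_sum_of_monoms'[OF that] by simp
  qed
  have row: "(\<Sum>j<d. S $$ (k, j) * monom 1 (d - 1 - j)) = w k" if k: "k < d" for k
  proof -
    have deg: "degree (w k) \<le> d - 1"
    proof (cases "k < n")
      case True
      have "degree (monom 1 (n - 1 - k) * p) \<le> (n - 1 - k) + m"
        unfolding m_def by (intro order_trans[OF degree_mult_le] add_right_mono degree_monom_le)
      then show ?thesis using True by (simp add: w_def d_def)
    next
      case False
      have "degree (monom 1 (d - 1 - k) * q) \<le> (d - 1 - k) + n"
        unfolding n_def by (intro order_trans[OF degree_mult_le] add_right_mono degree_monom_le)
      then show ?thesis using False k by (simp add: w_def d_def)
    qed
    have "S $$ (k, j) * monom 1 (d - 1 - j) = monom (coeff (w k) (d - 1 - j)) (d - 1 - j)"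
      if j: "j < d" for j
    proof -
      have "S $$ (k, j) = [:sylvester_mat p q $$ (k, j):]"
        using k j by (simp add: S_def d_def m_def n_def)
      also have "sylvester_mat p q $$ (k, j) = coeff (w k) (d - 1 - j)"
        using k j assms coeff_eq_0[of p] coeff_eq_0[of q]
        by (subst sylvester_index_mat)
          (auto simp: d_def m_def n_def w_def coeff_monom_mult le_diff_conv
            intro!: arg_cong[where f = "coeff p"] arg_cong[where f = "coeff q"])
      finally show ?thesis by (simp add: smult_monom)
    qed
    then show ?thesis using sum_monom[OF deg] by simp
  qed
  have adj: "(\<Sum>k<d. adj_mat S $$ (d - 1, k) * S $$ (k, j)) = (if j = d - 1 then det S else 0)"
    if "j < d" for j
  proof -
    have "(adj_mat S * S) $$ (d - 1, j) = (det S \<cdot>\<^sub>m 1\<^sub>m d) $$ (d - 1, j)"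
      by (simp only: adj_mat(3)[OF S])
    then show ?thesis
      using S adj_mat(1)[OF S] d that
      by (auto simp: scalar_prod_def lessThan_atLeast0)
  qed
  have "[:resultant p q:] = (\<Sum>j<d. (if j = d - 1 then det S else 0) * monom 1 (d - 1 - j))"
  proof -
    have "(\<Sum>j<d. (if j = d - 1 then det S else 0) * monom 1 (d - 1 - j))
        = (\<Sum>j<d. if j = d - 1 then det S else 0)"
      by (intro sum.cong) (auto simp: monom_0)
    then show ?thesis using d by (simp add: det)
  qed
  also have "\<dots> = (\<Sum>j<d. (\<Sum>k<d. adj_mat S $$ (d - 1, k) * S $$ (k, j)) * monom 1 (d - 1 - j))"
    by (intro sum.cong refl) (simp only: adj lessThan_iff)
  also have "\<dots> = (\<Sum>k<d. \<Sum>j<d. adj_mat S $$ (d - 1, k) * (S $$ (k, j) * monom 1 (d - 1 - j)))"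
    by (subst sum.swap) (simp add: sum_distrib_right mult.assoc)
  also have "\<dots> = (\<Sum>k<d. adj_mat S $$ (d - 1, k) * w k)"
    by (intro sum.cong refl) (simp only: sum_distrib_left[symmetric] row lessThan_iff)
  also have "\<dots> = (\<Sum>k<d. (if k < n then adj_mat S $$ (d - 1, k) * monom 1 (n - 1 - k) else 0) * p
        + (if k < n then 0 else adj_mat S $$ (d - 1, k) * monom 1 (d - 1 - k)) * q)"
    by (intro sum.cong) (auto simp: w_def mult.assoc)
  also have "\<dots> = (\<Sum>k<d. if k < n then adj_mat S $$ (d - 1, k) * monom 1 (n - 1 - k) else 0) * p
        + (\<Sum>k<d. if k < n then 0 else adj_mat S $$ (d - 1, k) * monom 1 (d - 1 - k)) * q"
    by (simp add: sum.distrib sum_distrib_right)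
  finally show ?thesis by (rule that)
qed

text \<open>The degree in the inner variable; for the zero polynomial it is
  \<open>0\<close>.\<close>

definition rdeg :: "'a::zero poly poly \<Rightarrow> nat" where
  "rdeg F = (MAX i\<in>{..degree F}. degree (coeff F i))"

lemma degree_coeff_le_rdeg: "degree (coeff F i) \<le> rdeg F"
proof (cases "i \<le> degree F")
  case True
  then show ?thesis unfolding rdeg_def by (intro Max_ge) auto
qed (simp add: coeff_eq_0)

lemma rdeg_le: "(\<And>i. degree (coeff F i) \<le> n) \<Longrightarrow> rdeg F \<le> n"
  unfolding rdeg_def by (intro Max.boundedI) auto

lemma rdeg_const [simp]: "rdeg [:c:] = degree c"
  by (simp add: rdeg_def)

text \<open>The maximum can be attained at a zero coefficient only if \<open>rdeg F = 0\<close>;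
  then the leading coefficient is a nonzero constant.\<close>

lemma ex_coeff_rdeg_nonzero:
  assumes "F \<noteq> 0"
  shows "\<exists>i. coeff (coeff F i) (rdeg F) \<noteq> 0"
proof (cases "rdeg F = 0")
  case True
  then have "degree (lead_coeff F) = 0" using degree_coeff_le_rdeg[of F "degree F"] by simp
  then have "coeff (lead_coeff F) 0 \<noteq> 0" using assms by (metis leading_coeff_0_iff)
  then show ?thesis using True by auto
next
  case False
  have "rdeg F \<in> (\<lambda>i. degree (coeff F i)) ` {..degree F}"
    unfolding rdeg_def by (intro Max_in) auto
  then obtain i where "rdeg F = degree (coeff F i)" by auto
  then have "coeff (coeff F i) (rdeg F) \<noteq> 0" using False by force
  then show ?thesis ..
qed

lemma coeff_mult_top:
  fixes p q :: "'a::comm_semiring_0 poly"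
  assumes "degree p \<le> a" "degree q \<le> b"
  shows "coeff (p * q) (a + b) = coeff p a * coeff q b"
proof -
  have "coeff (p * q) (a + b) = (\<Sum>i\<le>a + b. coeff p i * coeff q (a + b - i))"
    by (rule coeff_mult)
  also have "\<dots> = (\<Sum>i\<in>{a}. coeff p i * coeff q (a + b - i))"
  proof (rule sum.mono_neutral_right)
    show "\<forall>i\<in>{..a + b} - {a}. coeff p i * coeff q (a + b - i) = 0"
    proof
      fix i assume "i \<in> {..a + b} - {a}"
      then consider "a < i" | "b < a + b - i" by fastforce
      then show "coeff p i * coeff q (a + b - i) = 0"
        using assms by cases (simp_all add: coeff_eq_0)
    qed
  qed auto
  finally show ?thesis by simp
qed

text \<open>\<open>top P\<close> collects the terms of highest degree in the inner variable. Over an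
  integral domain \<open>top G * top H\<close> is nonzero, so these terms survive in
  \<open>G * H\<close>.\<close>

lemma rdeg_mult_ge:
  fixes G H :: "'a::idom poly poly"
  assumes "G \<noteq> 0" "H \<noteq> 0"
  shows "rdeg G + rdeg H \<le> rdeg (G * H)"
proof -
  define top where "top P = map_poly (\<lambda>c. coeff c (rdeg P)) P" for P :: "'a poly poly"
  have coeff_top: "coeff (top P) i = coeff (coeff P i) (rdeg P)" for P i
    by (simp add: top_def coeff_map_poly)
  have top_nz: "top P \<noteq> 0" if "P \<noteq> 0" for P
    using ex_coeff_rdeg_nonzero[OF that] coeff_top[of P] by (metis coeff_0)
  have coeff_GH: "coeff (coeff (G * H) i) (rdeg G + rdeg H) = coeff (top G * top H) i" for i
    by (simp add: coeff_mult[of G H] coeff_mult[of "top G"] coeff_sum coeff_top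
        coeff_mult_top degree_coeff_le_rdeg)
  have "top G * top H \<noteq> 0" using top_nz assms by simp
  then obtain i where "coeff (top G * top H) i \<noteq> 0" by (metis leading_coeff_0_iff)
  then have "rdeg G + rdeg H \<le> degree (coeff (G * H) i)"
    by (intro le_degree) (simp add: coeff_GH)
  then show ?thesis using degree_coeff_le_rdeg order_trans by blast
qed

lemma degree_resultant_le:
  fixes F G :: "'a::idom poly poly"
  assumes "rdeg F \<le> k" "rdeg G \<le> k"
  shows "degree (resultant F G) \<le> k * (degree F + degree G)"
  unfolding resultant_def
proof (rule degree_det_le)
  fix i j assume "i < degree F + degree G" "j < degree F + degree G"
  then show "degree (sylvester_mat F G $$ (i, j)) \<le> k"
    using assms order_trans[OF degree_coeff_le_rdeg] by (subst sylvester_index_mat) auto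
qed (rule sylvester_carrier_mat)

text \<open>If \<open>p\<close> has order \<open>n\<close> at \<open>c\<close>, its derivative has
  order at least \<open>n - 1\<close>, so the left side has order at least \<open>n + 1\<close>; the
  surplus zero must come from \<open>m\<close>.\<close>

lemma poly_eq_0_if_logarithmic_derivative:
  fixes p m :: "complex poly"
  assumes "p \<noteq> 0" and eq: "[:-c, 1:] ^ 2 * pderiv p = m * p"
  shows "poly m c = 0"
proof (rule ccontr)
  assume nz: "poly m c \<noteq> 0"
  define n where "n = order c p"
  obtain s where p: "p = [:-c, 1:] ^ n * s" and s: "\<not> [:-c, 1:] dvd s"
    using order_decomp[OF \<open>p \<noteq> 0\<close>, of c] by (auto simp: n_def)
  have "[:-c, 1:] ^ Suc n dvd [:-c, 1:] ^ 2 * pderiv p"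
  proof (cases n)
    case 0
    then show ?thesis by (intro dvd_mult2 le_imp_power_dvd) simp
  next
    case (Suc l)
    have "[:-c, 1:] ^ Suc n = [:-c, 1:] ^ 2 * [:-c, 1:] ^ l"
      by (simp only: Suc power_add[symmetric]) simp
    moreover have "[:-c, 1:] ^ l dvd pderiv p"
      unfolding p Suc pderiv_mult pderiv_power_Suc
      by (intro dvd_add[OF dvd_mult2[OF le_imp_power_dvd] dvd_mult[OF dvd_mult2[OF dvd_smult[OF dvd_refl]]]]) simp
    ultimately show ?thesis by (metis mult_dvd_mono dvd_refl)
  qed
  then have "[:-c, 1:] ^ n * [:-c, 1:] dvd [:-c, 1:] ^ n * (m * s)"
    by (simp only: eq power_Suc2) (simp only: p mult.left_commute[of m])
  then have "[:-c, 1:] dvd m * s" by (subst (asm) dvd_mult_cancel_left) simp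
  then have "poly (m * s) c = 0" by (simp only: poly_eq_0_iff_dvd)
  moreover have "poly s c \<noteq> 0" using s poly_eq_0_iff_dvd by blast
  ultimately show False using nz by simp
qed

section \<open>The Ramanujan vector field\<close>

lemma map_poly_pCons_zero:
  assumes "f 0 = 0"
  shows "map_poly f (pCons c p) = pCons (f c) (map_poly f p)"
  by (rule poly_eqI) (simp add: assms coeff_map_poly coeff_pCons split: nat.splits)

text \<open>In the coordinates x = E2 / sqrt E4 and r = E6 / sqrt E4 ^ 3, the derivation q d/dq becomes
  sqrt E4 / 12 times the polynomial vector field
  (2 x r - x^2 - 1) d/dx + 6 (r^2 - 1) d/dr.
  A polynomial F(x, r) is encoded with x as the outer and r as the inner variable.\<close>

definition der :: "complex poly poly \<Rightarrow> complex poly poly" where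
  "der F = pderiv F * [:[:-1:], [:0, 2:], [:-1:]:] + smult [:-6, 0, 6:] (map_poly pderiv F)"

text \<open>At \<open>i = 0\<close> the truncated \<open>i - 1\<close> does no harm, because the
  factor \<open>of_nat (i - 1)\<close> is then zero.\<close>

lemma coeff_der:
  "coeff (der F) i = [:0, 2 * of_nat i:] * coeff F i - of_nat (i - 1) * coeff F (i - 1)
     - of_nat (Suc i) * coeff F (Suc i) + [:-6, 0, 6:] * pderiv (coeff F i)"
proof -
  have "coeff (pderiv F * [:[:-1:], [:0, 2:], [:-1:]:]) i
      = [:0, 2 * of_nat i:] * coeff F i - of_nat (i - 1) * coeff F (i - 1) - of_nat (Suc i) * coeff F (Suc i)"
    (is "?l = ?r")
  proof -
    have eq: "[:0, 2 * of_nat i:] = of_nat i * [:0, 2 :: complex:]" for i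
      by (simp add: of_nat_poly)
    show ?thesis
      by (auto simp: eq coeff_pCons coeff_pderiv algebra_simps split: nat.splits)
  qed
  then show ?thesis by (simp add: der_def coeff_map_poly)
qed

lemma degree_der_le: "degree (der F) \<le> Suc (degree F)"
proof (rule degree_le, intro allI impI)
  fix i assume "Suc (degree F) < i"
  then show "coeff (der F) i = 0" by (simp add: coeff_der coeff_eq_0)
qed

lemma rdeg_der_le: "rdeg (der F) \<le> Suc (rdeg F)"
proof (rule rdeg_le)
  fix i
  have d: "degree (coeff F j) \<le> rdeg F" for j by (rule degree_coeff_le_rdeg)
  have "degree ([:0, 2 * of_nat i:] * coeff F i) \<le> Suc (rdeg F)"
    using d[of i] by (intro order_trans[OF degree_mult_le]) (auto simp: le_Suc_eq)
  moreover have "degree (of_nat n * coeff F j) \<le> Suc (rdeg F)" for n j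
    using d[of j] by (intro order_trans[OF degree_mult_le]) simp
  moreover have "degree ([:-6, 0, 6:] * pderiv (coeff F i)) \<le> Suc (rdeg F)"
  proof (cases "degree (coeff F i) = 0")
    \<comment> \<open>The count below relies on the derivative having degree one less, which
      truncated subtraction spoils for a constant coefficient.\<close>
    case True
    then have "pderiv (coeff F i) = 0" by (simp add: pderiv_eq_0_iff)
    then show ?thesis by simp
  next
    case False
    then show ?thesis using d[of i]
      by (intro order_trans[OF degree_mult_le]) (simp add: degree_pderiv)
  qed
  ultimately show "degree (coeff (der F) i) \<le> Suc (rdeg F)"
    unfolding coeff_der by (intro degree_add_le degree_diff_le)
qed

text \<open>On the line r = c the component 6 (r^2 - 1) vanishes, and 2 x c - x^2 - 1 equals -(x -
  c)^2.\<close>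

lemma der_restrict:
  assumes "c ^ 2 = 1"
  shows "map_poly (\<lambda>p. poly p c) (der F) = - ([:-c, 1:] ^ 2) * pderiv (map_poly (\<lambda>p. poly p c) F)"
proof (rule poly_eqI)
  fix i
  have c2: "c * c = 1" using assms by (simp add: power2_eq_square)
  show "coeff (map_poly (\<lambda>p. poly p c) (der F)) i
      = coeff (- ([:-c, 1:] ^ 2) * pderiv (map_poly (\<lambda>p. poly p c) F)) i"
    by (auto simp: coeff_map_poly coeff_der power2_eq_square coeff_pCons coeff_pderiv c2
        algebra_simps split: nat.splits)
qed

text \<open>Setting r = c is multiplicative, so \<open>poly_eq_0_if_logarithmic_derivative\<close>
  applies to the restricted \<open>F\<close>: the cofactor vanishes at the singular point x = r =
  c.\<close>

lemma der_multiple_restrict: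
  assumes eq: "der F = L * F" and c: "c ^ 2 = 1" and nz: "map_poly (\<lambda>p. poly p c) F \<noteq> 0"
  shows "poly (map_poly (\<lambda>p. poly p c) L) c = 0"
proof -
  define r where "r = map_poly (\<lambda>p. poly p c)"
  have "r (L * F) = r L * r F"
    by (rule poly_eqI) (simp add: r_def coeff_map_poly coeff_mult poly_sum)
  then have "[:-c, 1:] ^ 2 * pderiv (r F) = (- r L) * r F"
    using der_restrict[OF c, of F] by (simp add: eq r_def)
  then have "poly (- r L) c = 0"
    using nz by (intro poly_eq_0_if_logarithmic_derivative[of "r F"]) (simp_all add: r_def)
  then show ?thesis by (simp add: r_def)
qed

text \<open>The lines r = 1 and r = -1 are the only invariant curves that matter: on each of them the vector
  field restricts to -(x - r)^2 d/dx, which forces the cofactor L to be m (r - x), and then the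
  monomial x^i r^l of F maximising 2 i + 3 l would have to satisfy 2 i + 6 l = m.\<close>

lemma der_not_multiple:
  assumes eq: "der F = L * F" and deg: "0 < degree F"
    and nz1: "map_poly (\<lambda>p. poly p 1) F \<noteq> 0" and nz2: "map_poly (\<lambda>p. poly p (-1)) F \<noteq> 0"
  shows False
proof -
  define m where "m = degree F"
  have m: "0 < m" using deg by (simp add: m_def)
  have F: "F \<noteq> 0" using deg by auto
  have degL: "degree L \<le> 1"
  proof (cases "L = 0")
    case False
    then have "degree L + degree F = degree (der F)" using F by (simp add: eq degree_mult_eq)
    then show ?thesis using degree_der_le[of F] by simp
  qed simp
  have rdegL: "rdeg L \<le> 1"
  proof (cases "L = 0")
    case False
    then have "rdeg L + rdeg F \<le> rdeg (der F)" using F by (simp add: eq rdeg_mult_ge)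
    then show ?thesis using rdeg_der_le[of F] by simp
  qed (simp add: rdeg_def)
  define a b where "a = coeff L 0" and "b = coeff L 1"
  have L: "L = [:a, b:]"
    using degL by (auto intro!: poly_eqI simp: a_def b_def coeff_pCons coeff_eq_0 split: nat.splits)
  have coeff_LF: "coeff (der F) i = a * coeff F i + (if i = 0 then 0 else b * coeff F (i - 1))" for i
    by (simp add: eq L coeff_pCons split: nat.splits)
  have "- of_nat m * lead_coeff F = b * lead_coeff F"
    using coeff_LF[of "Suc m"] by (simp add: coeff_der m_def coeff_eq_0)
  then have b: "b = - of_nat m" using F by (metis mult_right_cancel leading_coeff_0_iff)
  \<comment> \<open>\<open>L\<close> vanishes at x = r = 1 and at x = r = -1. As \<open>a\<close> is
    linear in r, these two values determine it.\<close>
  have poly_a: "poly a 1 = of_nat m" "poly a (-1) = - of_nat m"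
    using der_multiple_restrict[OF eq _ nz1] der_multiple_restrict[OF eq _ nz2]
    by (auto simp: L b map_poly_pCons_zero of_nat_poly eq_neg_iff_add_eq_0)
  have "degree a \<le> 1"
    using order_trans[OF degree_coeff_le_rdeg rdegL, of 0] by (simp add: a_def)
  then have a: "a = [:coeff a 0, coeff a 1:]"
    by (auto intro!: poly_eqI simp: coeff_pCons coeff_eq_0 split: nat.splits)
  have sum: "coeff a 0 + coeff a 1 = of_nat m" using poly_a(1) by (subst (asm) a) simp
  moreover have "coeff a 0 - coeff a 1 = - of_nat m" using poly_a(2) by (subst (asm) a) simp
  ultimately have "(coeff a 0 + coeff a 1) + (coeff a 0 - coeff a 1) = 0" by simp
  then have "coeff a 0 = 0" by simp
  then have a': "a = [:0, of_nat m:]" using a sum by simp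
  define M where "M = {(i, l). coeff (coeff F i) l \<noteq> 0}"
  have "M \<subseteq> {..degree F} \<times> {..rdeg F}"
  proof clarify
    fix i l assume "(i, l) \<in> M"
    then have nz: "coeff (coeff F i) l \<noteq> 0" by (simp add: M_def)
    then have "i \<le> degree F" by (metis coeff_0 le_degree)
    moreover have "l \<le> rdeg F" using le_degree[OF nz] degree_coeff_le_rdeg[of F i] by simp
    ultimately show "i \<in> {..degree F} \<and> l \<in> {..rdeg F}" by simp
  qed
  then have fin: "finite M" by (rule finite_subset) simp
  \<comment> \<open>The leading monomial keeps \<open>M\<close> nonempty and later bounds the
    maximal weight below by 2 m.\<close>
  moreover have lead: "(m, degree (lead_coeff F)) \<in> M" using F by (simp add: M_def m_def)
  ultimately have "Max ((\<lambda>(j, k). 2 * j + 3 * k) ` M) \<in> (\<lambda>(j, k). 2 * j + 3 * k) ` M"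
    by (intro Max_in) auto
  then obtain i l where il: "(i, l) \<in> M"
    and il_max: "Max ((\<lambda>(j, k). 2 * j + 3 * k) ` M) = 2 * i + 3 * l" by auto
  have max: "2 * j + 3 * k \<le> 2 * i + 3 * l" if "(j, k) \<in> M" for j k
    unfolding il_max[symmetric] using fin that by (intro Max_ge) force+
  have vanish: "coeff (coeff F j) k = 0" if "2 * i + 3 * l < 2 * j + 3 * k" for j k
    using max[of j k] that by (force simp: M_def)
  \<comment> \<open>Compare coefficients of x^i r^(l+1): the other contributing monomials, such as
    x^(i-1) r^(l+1), outweigh x^i r^l and are absent from \<open>F\<close>.\<close>
  have "coeff (coeff (der F) i) (Suc l) = of_nat (2 * i + 6 * l) * coeff (coeff F i) l
      - of_nat (i - 1) * coeff (coeff F (i - 1)) (Suc l)"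
    using vanish[of "Suc i" "Suc l"] vanish[of i "Suc (Suc l)"]
    by (cases l) (simp_all add: coeff_der coeff_pderiv of_nat_poly algebra_simps)
  moreover have "coeff (coeff (der F) i) (Suc l) = of_nat m * coeff (coeff F i) l
      - (if i = 0 then 0 else of_nat m * coeff (coeff F (i - 1)) (Suc l))"
    by (simp add: coeff_LF a' b of_nat_poly)
  moreover have "of_nat (i - 1) * coeff (coeff F (i - 1)) (Suc l) = 0"
    "(if i = 0 then 0 else of_nat m * coeff (coeff F (i - 1)) (Suc l)) = 0"
    using vanish[of "i - 1" "Suc l"] by (cases i; simp)+
  ultimately have "of_nat (2 * i + 6 * l) * coeff (coeff F i) l = of_nat m * coeff (coeff F i) l"
    by (simp only: diff_zero)
  moreover have "coeff (coeff F i) l \<noteq> 0" using il by (simp add: M_def)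
  ultimately have "(of_nat (2 * i + 6 * l) :: complex) = of_nat m"
    by (metis mult_right_cancel)
  then have "2 * i + 6 * l = m" by (simp only: of_nat_eq_iff)
  \<comment> \<open>Then 2 m \<le> 2 i + 3 l \<le> 2 i + 6 l = m, impossible for positive
    \<open>m\<close>.\<close>
  moreover have "2 * m \<le> 2 * i + 3 * l"
    using max[OF lead] by simp
  ultimately show False using m by simp
qed

section \<open>The square root of E4 and the normalised series x and r\<close>

definition sqrt_E4 :: "complex fps" where
  "sqrt_E4 = fps_radical (\<lambda>_ _. 1) 2 E4"

text \<open>The constant term of \<open>E4\<close> is 1, and the root choice
  \<open>\<lambda>_ _. 1\<close> selects 1 as its square root.\<close>

lemma sqrt_E4_power2: "sqrt_E4 ^ 2 = E4"
  using power_radical[of E4 "\<lambda>_ _. 1" 1] by (simp add: sqrt_E4_def E4_def numeral_2_eq_2)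

lemma sqrt_E4_nth_0 [simp]: "fps_nth sqrt_E4 0 = 1"
  by (simp add: sqrt_E4_def)

lemma sqrt_E4_inverse [simp]: "sqrt_E4 * inverse sqrt_E4 = 1"
  by (simp add: inverse_mult_eq_1')

definition fps_x :: "complex fps" where "fps_x = E2 * inverse sqrt_E4"
definition fps_r :: "complex fps" where "fps_r = E6 * inverse sqrt_E4 ^ 3"

lemma E2_eq_sqrt_E4: "E2 = fps_x * sqrt_E4"
  by (simp add: fps_x_def mult.assoc mult.commute[of "inverse sqrt_E4"])

lemma E6_eq_sqrt_E4: "E6 = fps_r * sqrt_E4 ^ 3"
  by (simp add: fps_r_def mult.assoc power_mult_distrib[symmetric] mult.commute[of "inverse sqrt_E4"])

lemma theta_mult: "theta (f * g) = theta f * g + f * theta g"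
  by (simp add: algebra_simps)

lemma sqrt_E4_nonzero: "sqrt_E4 \<noteq> 0"
  using sqrt_E4_nth_0 by (metis fps_zero_nth zero_neq_one)

lemma theta_sqrt_E4: "6 * theta sqrt_E4 = sqrt_E4 ^ 2 * (fps_x - fps_r)"
proof -
  have "sqrt_E4 * (6 * theta sqrt_E4) = 3 * theta E4"
    unfolding sqrt_E4_power2[symmetric] power2_eq_square theta_mult by (simp add: algebra_simps)
  also have "\<dots> = E2 * E4 - E6" by (rule Ramanujan_E4)
  also have "\<dots> = sqrt_E4 * (sqrt_E4 ^ 2 * (fps_x - fps_r))"
    unfolding E2_eq_sqrt_E4 E6_eq_sqrt_E4 sqrt_E4_power2[symmetric]
    by (simp add: algebra_simps power2_eq_square power3_eq_cube)
  finally show ?thesis using sqrt_E4_nonzero by simp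
qed

text \<open>Together with \<open>theta_r\<close> this gives the two components of the vector field
  in \<open>der\<close>, with common factor \<open>sqrt_E4 / 12\<close>.\<close>

lemma theta_x: "12 * theta fps_x = sqrt_E4 * (2 * fps_x * fps_r - fps_x ^ 2 - 1)"
proof -
  have "sqrt_E4 * (12 * theta fps_x) + 2 * fps_x * (6 * theta sqrt_E4) = 12 * theta E2"
    unfolding E2_eq_sqrt_E4 theta_mult by (simp add: algebra_simps)
  also have "\<dots> = E2 ^ 2 - E4" by (rule Ramanujan_E2)
  also have "\<dots> = sqrt_E4 ^ 2 * (fps_x ^ 2 - 1)"
    unfolding E2_eq_sqrt_E4 sqrt_E4_power2[symmetric] by (simp add: algebra_simps power2_eq_square)
  finally have "sqrt_E4 * (12 * theta fps_x) = sqrt_E4 * (sqrt_E4 * (2 * fps_x * fps_r - fps_x ^ 2 - 1))"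
    unfolding theta_sqrt_E4 by (simp add: algebra_simps power2_eq_square)
  then show ?thesis using sqrt_E4_nonzero by simp
qed

lemma theta_r: "12 * theta fps_r = sqrt_E4 * (6 * fps_r ^ 2 - 6)"
proof -
  have "sqrt_E4 ^ 3 * (2 * theta fps_r) + sqrt_E4 ^ 2 * fps_r * (6 * theta sqrt_E4) = 2 * theta E6"
    unfolding E6_eq_sqrt_E4 theta_mult power3_eq_cube power2_eq_square by (simp add: algebra_simps)
  also have "\<dots> = E2 * E6 - E4 ^ 2" by (rule Ramanujan_E6)
  also have "\<dots> = sqrt_E4 ^ 4 * (fps_x * fps_r - 1)"
    unfolding E2_eq_sqrt_E4 E6_eq_sqrt_E4 sqrt_E4_power2[symmetric]
    by (simp add: algebra_simps eval_nat_numeral)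
  finally have "sqrt_E4 ^ 3 * (2 * theta fps_r) = sqrt_E4 ^ 3 * (sqrt_E4 * (fps_r ^ 2 - 1))"
    unfolding theta_sqrt_E4 by (simp add: algebra_simps eval_nat_numeral)
  then have "2 * theta fps_r = sqrt_E4 * (fps_r ^ 2 - 1)" using sqrt_E4_nonzero by simp
  then have "6 * (2 * theta fps_r) = 6 * (sqrt_E4 * (fps_r ^ 2 - 1))" by simp
  then show ?thesis by (simp add: algebra_simps)
qed

section \<open>Evaluation of polynomials at the normalised series\<close>

definition ev_r :: "complex poly \<Rightarrow> complex fps" where
  "ev_r c = eval_poly fps_const c fps_r"

definition ev :: "complex poly poly \<Rightarrow> complex fps" where
  "ev F = eval_poly ev_r F fps_x"

lemma comm_ring_hom_fps_const: "comm_ring_hom (fps_const :: complex \<Rightarrow> complex fps)"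
  by unfold_locales
    (simp_all add: fps_const_add[symmetric] fps_const_mult[symmetric] del: fps_const_add fps_const_mult)

lemma comm_ring_hom_eval_poly:
  assumes "comm_ring_hom h"
  shows "comm_ring_hom (\<lambda>p. eval_poly h p x)"
proof -
  interpret h: comm_ring_hom h by fact
  interpret map_h: map_poly_comm_ring_hom h ..
  show ?thesis by unfold_locales (simp_all add: eval_poly_def hom_distribs)
qed

lemma comm_ring_hom_ev_r: "comm_ring_hom ev_r"
  unfolding ev_r_def[abs_def] by (intro comm_ring_hom_eval_poly comm_ring_hom_fps_const)

lemma comm_ring_hom_ev: "comm_ring_hom ev"
  unfolding ev_def[abs_def] by (intro comm_ring_hom_eval_poly comm_ring_hom_ev_r)

interpretation ev_r: comm_ring_hom ev_r by (rule comm_ring_hom_ev_r)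
interpretation ev: comm_ring_hom ev by (rule comm_ring_hom_ev)

lemma ev_r_pCons: "ev_r (pCons a c) = fps_const a + fps_r * ev_r c"
  by (simp add: ev_r_def eval_poly_def map_poly_pCons_zero)

lemma ev_pCons: "ev (pCons c F) = ev_r c + fps_x * ev F"
  by (simp add: ev_def eval_poly_def map_poly_pCons_zero)

lemma theta_ev_r: "12 * theta (ev_r c) = sqrt_E4 * ev_r ([:-6, 0, 6:] * pderiv c)"
proof (induction c)
  case (pCons a c)
  have w: "ev_r [:-6, 0, 6:] = 6 * fps_r ^ 2 - 6"
    by (simp add: ev_r_pCons numeral_fps_const power2_eq_square algebra_simps)
  have "12 * theta (ev_r (pCons a c)) = 12 * theta fps_r * ev_r c + fps_r * (12 * theta (ev_r c))"
    by (simp add: ev_r_pCons algebra_simps)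
  also have "\<dots> = sqrt_E4 * (ev_r [:-6, 0, 6:] * (ev_r c + fps_r * ev_r (pderiv c)))"
    by (simp only: theta_r pCons.IH w ev_r.hom_mult) (simp add: algebra_simps)
  also have "ev_r c + fps_r * ev_r (pderiv c) = ev_r (pderiv (pCons a c))"
    by (simp add: pderiv_pCons ev_r.hom_add ev_r_pCons)
  finally show ?case by (simp only: ev_r.hom_mult)
qed simp

text \<open>This is the chain rule: the derivations correspond on x by \<open>theta_x\<close> and on
  polynomials in r by \<open>theta_ev_r\<close>; the induction follows the Horner form c + x
  F.\<close>

lemma theta_ev: "12 * theta (ev F) = sqrt_E4 * ev (der F)"
proof (induction F)
  case (pCons c F)
  define U :: "complex poly poly" where "U = [:[:-1:], [:0, 2:], [:-1:]:]"
  have U: "ev U = 2 * fps_x * fps_r - fps_x ^ 2 - 1"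
    by (simp add: U_def ev_pCons ev_r_pCons numeral_fps_const power2_eq_square algebra_simps
        flip: fps_const_neg)
  have der: "der (pCons c F) = [:[:-6, 0, 6:] * pderiv c:] + (pCons 0 (der F) + F * U)"
  proof -
    define X W :: "complex poly poly" where "X = [:0, 1:]" and "W = [:[:-6, 0, 6:]:]"
    have der_eq: "der P = pderiv P * U + W * map_poly pderiv P" for P
      by (simp add: der_def U_def W_def)
    have "der (pCons c F) = (F + X * pderiv F) * U + W * ([:pderiv c:] + X * map_poly pderiv F)"
      by (simp add: der_eq X_def pderiv_pCons map_poly_pCons_zero)
    also have "\<dots> = W * [:pderiv c:] + (X * der F + F * U)"
      unfolding der_eq by (simp only: algebra_simps)
    finally show ?thesis by (simp add: X_def W_def)
  qed
  have "12 * theta (ev (pCons c F))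
      = 12 * theta (ev_r c) + 12 * theta fps_x * ev F + fps_x * (12 * theta (ev F))"
    by (simp add: ev_pCons algebra_simps)
  also have "\<dots> = sqrt_E4 * (ev_r ([:-6, 0, 6:] * pderiv c) + (fps_x * ev (der F) + ev F * ev U))"
    unfolding theta_ev_r theta_x pCons.IH U by (simp add: algebra_simps)
  also have "ev_r ([:-6, 0, 6:] * pderiv c) + (fps_x * ev (der F) + ev F * ev U) = ev (der (pCons c F))"
    by (simp only: der ev.hom_add ev.hom_mult ev_pCons ev_r.hom_zero ev.hom_zero) simp
  finally show ?case .
qed (simp add: der_def)

section \<open>Order of vanishing\<close>

text \<open>Divisibility by \<open>fps_X ^ N\<close> expresses the order without an exception for
  the zero series, whose \<open>subdegree\<close> is \<open>0\<close>.\<close>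

lemma fps_X_power_dvd_iff:
  fixes f :: "'a::field fps"
  shows "fps_X ^ N dvd f \<longleftrightarrow> (\<forall>n<N. fps_nth f n = 0)"
proof (cases "f = 0")
  case False
  have "fps_X ^ N dvd f \<longleftrightarrow> N \<le> subdegree f"
    using False by (simp add: fps_dvd_iff)
  also have "\<dots> \<longleftrightarrow> (\<forall>n<N. fps_nth f n = 0)"
    using False nth_subdegree_nonzero[OF False] by (metis le_trans nth_less_subdegree_zero subdegree_geI not_le)
  finally show ?thesis .
qed simp

text \<open>The bounds force \<open>f\<close> and \<open>g\<close> to be nonzero, since every power
  of \<open>fps_X\<close> divides zero; then subdegrees add.\<close>

lemma ord_bound_mult:
  fixes f g :: "'a::field fps"
  assumes f: "\<And>N. fps_X ^ N dvd f \<Longrightarrow> N \<le> a" and g: "\<And>N. fps_X ^ N dvd g \<Longrightarrow> N \<le> b"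
    and dvd: "fps_X ^ N dvd f * g"
  shows "N \<le> a + b"
proof -
  have "f \<noteq> 0" using f[of "Suc a"] by auto
  moreover have "g \<noteq> 0" using g[of "Suc b"] by auto
  moreover have "fps_X ^ subdegree h dvd h" for h :: "'a fps"
    unfolding fps_X_power_dvd_iff by (blast intro: nth_less_subdegree_zero)
  then have "subdegree f \<le> a" "subdegree g \<le> b" by (blast intro: f g)+
  ultimately show ?thesis using dvd by (simp add: fps_dvd_iff)
qed

lemma fps_r_nth_0: "fps_nth fps_r 0 = 1"
  by (simp add: fps_r_def E6_def fps_power_zeroth_eq_one)

text \<open>The root of 1 + 240 q + ... is 1 + 120 q + ..., and -864 + 3 * 120 = -504. Hence r - 1
  has order exactly 1.\<close>

lemma fps_r_nth_1: "fps_nth fps_r 1 = - 864"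
proof -
  have "2 * fps_nth sqrt_E4 1 = fps_nth (sqrt_E4 ^ 2) 1"
    by (simp add: power2_eq_square fps_mult_nth)
  then have s: "fps_nth sqrt_E4 1 = 120"
    by (simp add: sqrt_E4_power2 E4_def sigma_def)
  have "fps_nth (fps_r * sqrt_E4 ^ 3) 1 = - 504"
    by (simp add: E6_eq_sqrt_E4[symmetric] E6_def sigma_def)
  then show ?thesis
    by (simp add: power3_eq_cube fps_mult_nth s[unfolded One_nat_def] fps_r_nth_0 eq_neg_iff_add_eq_0 add.commute)
qed

lemma ev_r_linear: "ev_r [:-c, 1:] = fps_r - fps_const c"
  by (simp add: ev_r_pCons)

lemma ord_linear:
  assumes "c ^ 2 = 1" and dvd: "fps_X ^ N dvd ev_r [:-c, 1:]"
  shows "N \<le> 1"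
proof (rule ccontr)
  assume "\<not> N \<le> 1"
  then have "fps_nth (ev_r [:-c, 1:]) 1 = 0" using dvd by (simp add: fps_X_power_dvd_iff)
  then show False unfolding ev_r_linear by (simp add: fps_r_nth_1[unfolded One_nat_def])
qed

text \<open>At q = 0 the series \<open>fps_r\<close> is 1, so a polynomial with no zero at 1
  evaluates to a unit, while each factor r - 1 adds at most one to the order.\<close>

lemma ord_ev_r:
  assumes "c \<noteq> 0" "fps_X ^ N dvd ev_r c"
  shows "N \<le> degree c"
proof -
  obtain q where c: "c = [:-1, 1:] ^ order 1 c * q" and q: "\<not> [:-1, 1:] dvd q"
    using order_decomp[OF assms(1), of 1] by auto
  have "fps_nth (ev_r p) 0 = poly p 1" for p
    by (induction p) (simp_all add: ev_r_pCons fps_r_nth_0)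
  then have "fps_nth (ev_r q) 0 \<noteq> 0" using q by (metis poly_eq_0_iff_dvd)
  then have q0: "M \<le> 0" if "fps_X ^ M dvd ev_r q" for M
    using that by (cases M) (auto simp: fps_X_power_dvd_iff)
  have pow: "M \<le> k" if "fps_X ^ M dvd ev_r ([:-1, 1:] ^ k)" for k M
    using that
  proof (induction k arbitrary: M)
    case 0
    then show ?case by (cases M) (auto simp: fps_X_power_dvd_iff)
  next
    case (Suc k)
    have "fps_X ^ M dvd ev_r [:-1, 1:] * ev_r ([:-1, 1:] ^ k)"
      using Suc.prems by (simp only: power_Suc ev_r.hom_mult)
    then have "M \<le> 1 + k"
      by (rule ord_bound_mult[rotated 2]) (erule ord_linear[OF one_power2] Suc.IH)+
    then show ?case by simp
  qed
  have "fps_X ^ N dvd ev_r ([:-1, 1:] ^ order 1 c) * ev_r q"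
    using assms(2) by (subst (asm) c) (simp only: ev_r.hom_mult)
  then have "N \<le> order 1 c + 0" by (rule ord_bound_mult[rotated 2]) (erule pow q0)+
  also have "\<dots> \<le> degree c" using order_degree[OF assms(1)] by simp
  finally show ?thesis .
qed

lemma fps_X_power_dvd_theta: "fps_X ^ N dvd f \<Longrightarrow> fps_X ^ N dvd theta f"
  unfolding fps_X_power_dvd_iff theta_nth by simp

text \<open>\<open>theta\<close> multiplies the coefficient of q^n by n and \<open>sqrt_E4\<close>
  is a unit, so \<open>der\<close> does not lower the order.\<close>

lemma fps_X_power_dvd_ev_der:
  assumes "fps_X ^ N dvd ev F"
  shows "fps_X ^ N dvd ev (der F)"
proof -
  have "ev (der F) = (inverse sqrt_E4 * 12) * theta (ev F)"
    by (simp only: mult.assoc theta_ev) (simp add: mult.assoc[symmetric] mult.commute[of "inverse sqrt_E4"])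
  then show ?thesis using fps_X_power_dvd_theta[OF assms] by simp
qed

text \<open>The exact shape matters only in that it is superadditive, dominates the degree of the resultant
  of F and its derivative when F involves x, and is at least 1 for r - 1.\<close>

definition deg_bound :: "complex poly poly \<Rightarrow> nat" where
  "deg_bound F = 2 * degree F * rdeg F + 3 * degree F + rdeg F"

lemma deg_bound_mult_ge:
  assumes "G \<noteq> 0" "H \<noteq> 0"
  shows "deg_bound G + deg_bound H \<le> deg_bound (G * H)"
proof -
  have d: "degree (G * H) = degree G + degree H" using assms by (rule degree_mult_eq)
  have r: "rdeg G + rdeg H \<le> rdeg (G * H)" using assms by (rule rdeg_mult_ge)
  have "deg_bound G + deg_bound H \<le> 2 * (degree G + degree H) * (rdeg G + rdeg H)
      + 3 * (degree G + degree H) + (rdeg G + rdeg H)"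
    by (simp add: deg_bound_def algebra_simps)
  also have "\<dots> \<le> deg_bound (G * H)"
    unfolding deg_bound_def d using r by (intro add_mono mult_le_mono) auto
  finally show ?thesis .
qed

lemma ord_ev_le_deg_bound:
  assumes "F \<noteq> 0" "fps_X ^ N dvd ev F"
  shows "N \<le> deg_bound F"
  using assms
proof (induction "degree F + rdeg F" arbitrary: F N rule: less_induct)
  case less
  note F = \<open>F \<noteq> 0\<close> and dvd = \<open>fps_X ^ N dvd ev F\<close>
  \<comment> \<open>A proper factorisation is settled by induction: orders add and
    \<open>deg_bound\<close> is superadditive.\<close>
  have factor: "N \<le> deg_bound F" if GH: "F = G * H" and "0 < degree G + rdeg G" "0 < degree H + rdeg H" for G H
  proof -
    have nz: "G \<noteq> 0" "H \<noteq> 0" using F GH by auto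
    have "degree F = degree G + degree H" using nz by (simp add: GH degree_mult_eq)
    moreover have "rdeg G + rdeg H \<le> rdeg F" using nz by (simp add: GH rdeg_mult_ge)
    ultimately have lt: "degree G + rdeg G < degree F + rdeg F" "degree H + rdeg H < degree F + rdeg F"
      using that by linarith+
    have "fps_X ^ N dvd ev G * ev H" using dvd by (simp add: GH ev.hom_mult)
    then have "N \<le> deg_bound G + deg_bound H"
      by (rule ord_bound_mult[rotated 2])
        (erule less.hyps[OF lt(1) nz(1)] less.hyps[OF lt(2) nz(2)])+
    then show ?thesis using deg_bound_mult_ge[OF nz] by (simp add: GH)
  qed
  consider "degree F = 0" | "0 < degree F" "degree (gcd F (der F)) = 0"
    | "0 < degree F" "0 < degree (gcd F (der F))" by linarith
  then show ?case
  proof cases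
    case 1
    then obtain c where c: "F = [:c:]" by (rule degree_eq_zeroE)
    then have "N \<le> degree c" using F dvd by (intro ord_ev_r) (simp_all add: ev_pCons ev.hom_zero)
    then show ?thesis by (simp add: c deg_bound_def)
  next
    case 2
    have res: "resultant F (der F) \<noteq> 0" using 2 by (simp add: resultant_0_gcd)
    obtain U V where "[:resultant F (der F):] = U * F + V * der F"
      using resultant_in_ideal[OF 2(1)] .
    then have "ev_r (resultant F (der F)) = ev U * ev F + ev V * ev (der F)"
      by (metis add_0_right ev.hom_add ev.hom_mult ev.hom_zero ev_pCons mult_zero_right)
    then have "fps_X ^ N dvd ev_r (resultant F (der F))"
      using dvd fps_X_power_dvd_ev_der[OF dvd] by simp
    then have "N \<le> degree (resultant F (der F))" by (rule ord_ev_r[OF res])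
    also have "\<dots> \<le> Suc (rdeg F) * (degree F + degree (der F))"
      using rdeg_der_le by (intro degree_resultant_le) simp_all
    also have "\<dots> \<le> Suc (rdeg F) * (degree F + Suc (degree F))"
      using degree_der_le by (intro mult_le_mono add_mono) simp_all
    \<comment> \<open>With D = \<open>degree F\<close> and R = \<open>rdeg F\<close>, (R + 1)(2 D +
      1) = 2 D R + 2 D + R + 1, and the 1 is at most D.\<close>
    also have "\<dots> \<le> deg_bound F"
      using 2(1) by (simp add: deg_bound_def algebra_simps)
    finally show ?thesis .
  next
    case 3
    define G where "G = gcd F (der F)"
    have degG: "0 < degree G" using 3(2) by (simp add: G_def)
    obtain H where GH: "F = G * H" unfolding G_def using gcd_dvd1 by (blast elim: dvdE)
    show ?thesis
    proof (cases "0 < degree H + rdeg H")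
      case True
      then show ?thesis using degG by (intro factor[OF GH]) simp_all
    next
      \<comment> \<open>\<open>H\<close> is a constant, so \<open>F\<close> divides the gcd and
        hence \<open>der F\<close>; by \<open>der_not_multiple\<close> it vanishes on r = 1 or on r
        = -1.\<close>
      case False
      then obtain h where h: "H = [:[:h:]:]"
        by (metis add_is_0 degree_eq_zeroE neq0_conv rdeg_const)
      then have "h \<noteq> 0" using F GH by auto
      then have "G = F * [:[:inverse h:]:]" by (simp add: GH h)
      then have "F dvd G" by (rule dvdI)
      then have "F dvd der F" unfolding G_def by simp
      then obtain L where L: "der F = L * F" by (metis dvd_def mult.commute)
      from der_not_multiple[OF L 3(1)]
      have "\<exists>c. c ^ 2 = 1 \<and> map_poly (\<lambda>p. poly p c) F = 0"
        by (metis one_power2 power2_minus)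
      then obtain c where c: "c ^ 2 = 1" and zero: "map_poly (\<lambda>p. poly p c) F = 0" by blast
      have "[:-c, 1:] dvd coeff F i" for i
        using zero by (metis coeff_0 coeff_map_poly poly_0 poly_eq_0_iff_dvd)
      then have "[:[:-c, 1:]:] dvd F" by (rule iffD2[OF const_poly_dvd_iff, OF allI])
      then obtain K where K: "F = [:[:-c, 1:]:] * K" by (elim dvdE)
      \<comment> \<open>Dividing by a factor in r alone keeps the degree in x, so the factorisation
        is proper.\<close>
      have "0 < degree K" using 3(1) F by (auto simp: K)
      then show ?thesis using K by (intro factor[OF K]) simp_all
    qed
  qed
qed

section \<open>Quasimodular forms as polynomials, and the final bound\<close>

lemma finite_wt_triples: "finite (wt_triples k)"
proof (rule finite_subset)
  show "wt_triples k \<subseteq> {..k} \<times> {..k} \<times> {..k}"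
  proof
    fix t assume "t \<in> wt_triples k"
    then obtain a b c where t: "t = (a, b, c)" "2 * a + 4 * b + 6 * c = 2 * k"
      unfolding wt_triples_def by blast
    then have "a \<le> k" "b \<le> k" "c \<le> k" by linarith+
    then show "t \<in> {..k} \<times> {..k} \<times> {..k}" by (simp add: t)
  qed
qed simp

text \<open>As a + 2 b + 3 c = k, each product equals \<open>sqrt_E4 ^ k\<close> times x^a r^c, with
  a at most k and c at most k / 3.\<close>

lemma QM_eq_ev:
  assumes "f \<in> QM k"
  obtains F where "f = sqrt_E4 ^ k * ev F" "degree F \<le> k" "3 * rdeg F \<le> k"
proof -
  obtain coef where f: "f = (\<Sum>(a, b, c)\<in>wt_triples k. fps_const (coef (a, b, c)) * E2 ^ a * E4 ^ b * E6 ^ c)"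
    using assms by (auto simp: QM_def)
  define F where "F = (\<Sum>(a, b, c)\<in>wt_triples k. monom (monom (coef (a, b, c)) c) a)"
  have ev_monom: "ev (monom (monom u c) a) = fps_const u * fps_r ^ c * fps_x ^ a" for u c a
  proof -
    have "ev_r (monom u c) = fps_const u * fps_r ^ c"
      by (induction c) (simp_all add: monom_0 monom_Suc ev_r_pCons)
    then show ?thesis by (induction a) (simp_all add: monom_0 monom_Suc ev_pCons ev.hom_zero ev_r.hom_zero)
  qed
  have "f = sqrt_E4 ^ k * ev F"
    unfolding f F_def ev.hom_sum sum_distrib_left
  proof (intro sum.cong refl, clarify)
    fix a b c assume "(a, b, c) \<in> wt_triples k"
    then have k: "k = a + 2 * b + 3 * c" by (simp add: wt_triples_def)
    show "fps_const (coef (a, b, c)) * E2 ^ a * E4 ^ b * E6 ^ c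
        = sqrt_E4 ^ k * ev (monom (monom (coef (a, b, c)) c) a)"
      unfolding ev_monom E2_eq_sqrt_E4 E6_eq_sqrt_E4 sqrt_E4_power2[symmetric] k
      by (simp only: power_mult_distrib power_add power_mult[symmetric] mult_ac)
  qed
  moreover have "degree F \<le> k"
    unfolding F_def
  proof (intro degree_sum_le finite_wt_triples, clarify)
    fix a b c assume "(a, b, c) \<in> wt_triples k"
    then show "degree (monom (monom (coef (a, b, c)) c) a) \<le> k"
      by (intro order_trans[OF degree_monom_le]) (simp add: wt_triples_def)
  qed
  moreover have "rdeg F \<le> k div 3"
  proof (rule rdeg_le)
    fix i
    show "degree (coeff F i) \<le> k div 3"
      unfolding F_def coeff_sum
    proof (intro degree_sum_le finite_wt_triples, clarify)
      fix a b c assume "(a, b, c) \<in> wt_triples k"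
      then have "c \<le> k div 3" by (auto simp: wt_triples_def)
      then show "degree (coeff (monom (monom (coef (a, b, c)) c) a) i) \<le> k div 3"
        by (auto intro: order_trans[OF degree_monom_le])
    qed
  qed
  ultimately show ?thesis by (intro that) auto
qed

text \<open>\<open>deg_bound\<close> with degrees k and k / 3 is (2 k^2 + 10 k) / 3; the factor 3
  clears the denominator.\<close>

lemma QM_eq_0:
  assumes "f \<in> QM k" and "3 * N > 2 * k ^ 2 + 10 * k" and "\<forall>n<N. fps_nth f n = 0"
  shows "f = 0"
proof -
  obtain F where f: "f = sqrt_E4 ^ k * ev F" and deg: "degree F \<le> k" "3 * rdeg F \<le> k"
    using QM_eq_ev[OF assms(1)] .
  have "F = 0"
  proof (rule ccontr)
    assume F: "F \<noteq> 0"
    have "inverse sqrt_E4 ^ k * f = ev F"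
      by (simp add: f mult.assoc[symmetric] power_mult_distrib[symmetric] mult.commute[of "inverse sqrt_E4"])
    moreover have "fps_X ^ N dvd f" using assms(3) by (simp add: fps_X_power_dvd_iff)
    ultimately have "fps_X ^ N dvd ev F" by (metis dvd_mult)
    then have "N \<le> deg_bound F" by (rule ord_ev_le_deg_bound[OF F])
    then have "3 * N \<le> 2 * degree F * (3 * rdeg F) + 9 * degree F + 3 * rdeg F"
      by (simp add: deg_bound_def)
    also have "\<dots> \<le> 2 * k * k + 9 * k + k"
      using deg by (intro add_mono mult_le_mono) simp_all
    finally show False using assms(2) by (simp add: power2_eq_square)
  qed
  then show ?thesis by (simp add: f ev.hom_zero)
qed

text \<open>As e \<le> 3 \<le> k, the logarithm is at least 1 and the right side at least 3 k^4 / 2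
  + 3. The \<open>Suc\<close> counts the indices from 0 to the ceiling.\<close>

lemma bound_large:
  assumes "3 \<le> k"
  shows "2 * k ^ 2 + 10 * k < 3 * Suc (nat \<lceil>real k ^ 4 * ln (real k) / 2\<rceil>)"
proof -
  have "exp 1 \<le> real k" using assms exp_le by linarith
  then have "1 \<le> ln (real k)" using assms by (subst ln_ge_iff) auto
  then have "real k ^ 4 / 2 \<le> real k ^ 4 * ln (real k) / 2"
    using mult_left_mono[of 1 "ln (real k)" "real k ^ 4"] by simp
  also have "\<dots> \<le> real (nat \<lceil>real k ^ 4 * ln (real k) / 2\<rceil>)" by linarith
  finally have le: "real k ^ 4 \<le> 2 * real (nat \<lceil>real k ^ 4 * ln (real k) / 2\<rceil>)" by simp
  have "9 * real k ^ 2 \<le> real k ^ 2 * real k ^ 2"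
    using assms power_mono[of 3 "real k" 2] by (intro mult_right_mono) simp_all
  then have k4: "9 * real k ^ 2 \<le> real k ^ 4" by (simp add: power_add[symmetric])
  have k2: "3 * real k \<le> real k ^ 2" using assms by (simp add: power2_eq_square)
  have "real (2 * k ^ 2 + 10 * k) < real (3 * Suc (nat \<lceil>real k ^ 4 * ln (real k) / 2\<rceil>))"
    using le k4 k2 by simp
  then show ?thesis by (simp only: of_nat_less_iff)
qed

theorem theorem1p4:
  fixes k :: nat and f :: "complex fps"
  assumes "k \<ge> 1"
    and "f \<in> QM k"
    and "\<forall>n \<le> nat \<lceil>real k ^ 4 * ln (real k) / 2\<rceil>. fps_nth f n = 0"
  shows "f = 0"
proof -
  obtain coef where f: "f = (\<Sum>(a, b, c)\<in>wt_triples k. fps_const (coef (a, b, c)) * E2 ^ a * E4 ^ b * E6 ^ c)"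
    using assms(2) by (auto simp: QM_def)
  \<comment> \<open>For k = 1 and k = 2, \<open>QM_eq_0\<close> would need 12 < 3 and 28 < 21, so
    these weights are treated by hand.\<close>
  consider "k = 1" | "k = 2" | "3 \<le> k" using assms(1) by linarith
  then show ?thesis
  proof cases
    case 1
    have "wt_triples 1 = {(1, 0, 0)}"
    proof (intro equalityI subsetI)
      fix t assume "t \<in> wt_triples 1"
      then obtain a b c where t: "t = (a, b, c)" "2 * a + 4 * b + 6 * c = 2 * 1" by (auto simp: wt_triples_def)
      have "a = 1" "b = 0" "c = 0" using t(2) by presburger+
      then show "t \<in> {(1, 0, 0)}" by (simp add: t(1))
    qed (auto simp: wt_triples_def)
    then have "f = fps_const (coef (1, 0, 0)) * E2" by (simp add: f 1)
    moreover have "fps_nth f 0 = 0" using assms(3) by simp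
    ultimately show ?thesis by (simp add: E2_def)
  next
    case 2
    have "wt_triples 2 = {(2, 0, 0), (0, 1, 0)}"
    proof (intro equalityI subsetI)
      fix t assume "t \<in> wt_triples 2"
      then obtain a b c where t: "t = (a, b, c)" "2 * a + 4 * b + 6 * c = 2 * 2" by (auto simp: wt_triples_def)
      have "c = 0" "a = 2 \<and> b = 0 \<or> a = 0 \<and> b = 1" using t(2) by presburger+
      then show "t \<in> {(2, 0, 0), (0, 1, 0)}" using t by auto
    qed (auto simp: wt_triples_def)
    then have f2: "f = fps_const (coef (2, 0, 0)) * E2 ^ 2 + fps_const (coef (0, 1, 0)) * E4"
      by (simp add: f 2)
    have "0 < real 2 ^ 4 * ln (real 2) / 2" by simp
    then have "1 \<le> nat \<lceil>real k ^ 4 * ln (real k) / 2\<rceil>" unfolding 2 by linarith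
    then have zero: "fps_nth f 0 = 0" "fps_nth f 1 = 0" using assms(3) by auto
    \<comment> \<open>E2^2 = 1 - 48 q + ... and E4 = 1 + 240 q + ..., so the first two coefficients
      form a nonsingular linear system.\<close>
    have "coef (0, 1, 0) = - coef (2, 0, 0)"
      using zero(1) by (simp add: f2 E2_def E4_def power2_eq_square eq_neg_iff_add_eq_0 add.commute)
    moreover have "240 * coef (0, 1, 0) - 48 * coef (2, 0, 0) = 0"
      using zero(2) by (simp add: f2 E2_def E4_def sigma_def power2_eq_square fps_mult_nth algebra_simps)
    ultimately show ?thesis by (simp add: f2)
  next
    case 3
    then show ?thesis using assms(3) by (intro QM_eq_0[OF assms(2) bound_large]) (auto simp: less_Suc_eq_le)
  qed
qed

end
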